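(* Let $(m,r)\in\mathcal R$ and let $X$ be a $\mathbb Z_+$-valued random variable. (i) $E((m,r)\odot X\mid X)=mX$. (ii) $E([(m,r)\odot X]^2\mid X)=(2r+1)mX+m^2X(X-1)$. (iii) $\mathrm{Var}((m,r)\odot X\mid X)=m(2r+1-m)X$. (iv) $E((m,r)\odot X)=mE(X)$ and $\mathrm{Var}((m,r)\odot X)=m^2\,\mathrm{Var}(X)+m(2r+1-m)E(X)$. (v) For $k\ge0$, $$P((m,r)\odot X=k\mid X)=\begin{cases}\bigl(1-\frac{m}{r+1}\bigr)^X & \text{if } k=0,\\[1mm] \bigl(1-\frac{m}{r+1}\bigr)^X\bigl(\frac{r}{r+1}\bigr)^k\displaystyle\sum_{i=0}^{\min(k,X)}\binom{X}{i}\binom{k-1}{i-1}\Bigl(\frac{m}{r(r+1-m)}\Bigr)^i & \text{if } k\ge1.\end{cases}$$ (vi) If $Y$ is a $\mathbb Z_+$-valued random variable independent of $X$, then $(m,r)\odot(X+Y)\overset{d}{=}(m,r)\odot X+(m,r)\odot Y$.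
   Context: $\mathcal R=\{(m,r)\in\mathbb R^2: r\ge 0,\ 0<m\le r+1\}$. For $(m,r)\in\mathcal R$, $\psi_{m,r}(s)=1-m\frac{1-s}{1+r(1-s)}$, $s\in[0,1]$, which is a probability generating function. For a $\mathbb Z_+$-valued random variable $X$, $(m,r)\odot X=\sum_{i=1}^X Z_i$ (an empty sum is $0$), where $\{Z_i\}$ is a sequence of iid $\mathbb Z_+$-valued random variables, independent of $X$, with common probability generating function $\psi_{m,r}$. In (vi), the two operations on the right-hand side are understood to be performed independently. Notational conventions: $0^0=1$ and $\binom{k-1}{-1}=0$ for $k\ge1$. $\overset{d}{=}$ denotes equality in distribution.
   Formalization: In (v) with k ≥ 1, the printed formula divides by r(r+1-m) and is undefined when r = 0 or m = r+1; in these boundary cases it is replaced by its continuous extension, with the prefactors cancelled against the denominators and 0^0 = 1. *)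

theory Defs
  imports "HOL-Probability.Probability"
begin

definition param_region :: "(real \<times> real) set" where
  "param_region = {(m, r). r \<ge> 0 \<and> 0 < m \<and> m \<le> r + 1}"

definition psi :: "real \<Rightarrow> real \<Rightarrow> real \<Rightarrow> real" where
  "psi m r s = 1 - m * ((1 - s) / (1 + r * (1 - s)))"

definition has_pgf :: "'a measure \<Rightarrow> ('a \<Rightarrow> nat) \<Rightarrow> (real \<Rightarrow> real) \<Rightarrow> bool" where
  "has_pgf M V \<phi> \<longleftrightarrow> (\<forall>s\<in>{0..1}. (\<integral>\<omega>. s ^ V \<omega> \<partial>M) = \<phi> s)"

abbreviation nat_space :: "nat measure" where
  "nat_space \<equiv> count_space UNIV"

abbreviation seq_space :: "(nat \<Rightarrow> nat) measure" where
  "seq_space \<equiv> (\<Pi>\<^sub>M i\<in>UNIV. nat_space)"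

definition seq_rv :: "(nat \<Rightarrow> 'a \<Rightarrow> nat) \<Rightarrow> 'a \<Rightarrow> nat \<Rightarrow> nat" where
  "seq_rv Z \<omega> = (\<lambda>i. Z i \<omega>)"

text \<open>Independence of two random variables with values in spaces of possibly different type;
  \<open>prob_space.indep_var\<close> requires a common value type.\<close>

definition indep_rv ::
    "'a measure \<Rightarrow> 'b measure \<Rightarrow> ('a \<Rightarrow> 'b) \<Rightarrow> 'c measure \<Rightarrow> ('a \<Rightarrow> 'c) \<Rightarrow> bool" where
  "indep_rv M N\<^sub>1 U N\<^sub>2 V \<longleftrightarrow>
     U \<in> measurable M N\<^sub>1 \<and> V \<in> measurable M N\<^sub>2 \<and>
     prob_space.indep_set M
       (sets (vimage_algebra (space M) U N\<^sub>1)) (sets (vimage_algebra (space M) V N\<^sub>2))"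

text \<open>The sequence \<open>Z 0, Z 1, \<dots>\<close> is iid with generating function \<open>psi m r\<close> and, as a whole,
  independent of \<open>X\<close>. A common generating function on \<open>[0,1]\<close> already makes the \<open>Z i\<close>
  identically distributed.\<close>

definition thinning_seq ::
    "'a measure \<Rightarrow> real \<Rightarrow> real \<Rightarrow> ('a \<Rightarrow> nat) \<Rightarrow> (nat \<Rightarrow> 'a \<Rightarrow> nat) \<Rightarrow> bool" where
  "thinning_seq M m r X Z \<longleftrightarrow>
     prob_space.indep_vars M (\<lambda>_. nat_space) Z UNIV \<and>
     (\<forall>i. has_pgf M (Z i) (psi m r)) \<and>
     indep_rv M nat_space X seq_space (seq_rv Z)"

text \<open>The random variable \<open>(m, r) \<odot> X\<close> built from such a sequence; the parameters enter only
  through the law of \<open>Z\<close>. The summands are indexed from \<open>0\<close>.\<close>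

definition thin :: "(nat \<Rightarrow> 'a \<Rightarrow> nat) \<Rightarrow> ('a \<Rightarrow> nat) \<Rightarrow> 'a \<Rightarrow> nat" where
  "thin Z X \<omega> = (\<Sum>i<X \<omega>. Z i \<omega>)"

definition sigma_gen :: "'a measure \<Rightarrow> ('a \<Rightarrow> nat) \<Rightarrow> 'a measure" where
  "sigma_gen M X = vimage_algebra (space M) X nat_space"

text \<open>Moments take values in \<open>[0,\<infinity>]\<close>, since \<open>X\<close> need not be integrable. If the mean of a
  \<open>nat\<close>-valued variable is infinite, the Bochner integral below is \<open>0\<close> and its variance is
  \<open>\<infinity>\<close>.\<close>

definition ext_variance :: "'a measure \<Rightarrow> ('a \<Rightarrow> real) \<Rightarrow> ennreal" where
  "ext_variance M f = (\<integral>\<^sup>+\<omega>. ennreal ((f \<omega> - (\<integral>\<eta>. f \<eta> \<partial>M))\<^sup>2) \<partial>M)"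

text \<open>For nonnegative \<open>f\<close>, \<open>real_cond_exp\<close> is the real part of \<open>nn_cond_exp\<close>, so the centring
  is the right one as soon as the conditional mean is almost surely finite.\<close>

definition cond_variance :: "'a measure \<Rightarrow> 'a measure \<Rightarrow> ('a \<Rightarrow> real) \<Rightarrow> 'a \<Rightarrow> ennreal" where
  "cond_variance M F f =
     nn_cond_exp M F (\<lambda>\<omega>. ennreal ((f \<omega> - real_cond_exp M F f \<omega>)\<^sup>2))"

definition cond_probability :: "'a measure \<Rightarrow> 'a measure \<Rightarrow> 'a set \<Rightarrow> 'a \<Rightarrow> real" where
  "cond_probability M F A = real_cond_exp M F (indicator A)"

text \<open>The coefficient \<open>binom (k-1) (i-1)\<close> for \<open>k \<ge> 1\<close>, with \<open>binom (k-1) (-1) = 0\<close>; truncated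
  subtraction would give \<open>1\<close> at \<open>i = 0\<close>.\<close>

definition choose_pred :: "nat \<Rightarrow> nat \<Rightarrow> nat" where
  "choose_pred k i = (if i = 0 then 0 else (k - 1) choose (i - 1))"

text \<open>Conditional probability of the value \<open>k\<close> given \<open>X = n\<close>. For \<open>k \<ge> 1\<close> the closed formula
  divides by \<open>r * (r + 1 - m)\<close>. On the boundary \<open>r = 0\<close> or \<open>m = r + 1\<close>, where it reads
  \<open>0 \<cdot> \<infinity>\<close>, it is understood as its continuous extension: the prefactors are multiplied into
  the sum and cancelled against the denominators, using
  \<open>(1 - m/(r+1)) * (r/(r+1)) * (m/(r*(r+1-m))) = m/(r+1)\<^sup>2\<close> and \<open>0 ^ 0 = 1\<close>.\<close>

definition thin_mass :: "real \<Rightarrow> real \<Rightarrow> nat \<Rightarrow> nat \<Rightarrow> real" where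
  "thin_mass m r n k =
     (if k = 0 then (1 - m / (r + 1)) ^ n
      else if r \<noteq> 0 \<and> m \<noteq> r + 1 then
        (1 - m / (r + 1)) ^ n * (r / (r + 1)) ^ k *
        (\<Sum>i = 0..min k n. real (n choose i) * real (choose_pred k i) *
            (m / (r * (r + 1 - m))) ^ i)
      else
        (\<Sum>i = 0..min k n. real (n choose i) * real (choose_pred k i) *
            (1 - m / (r + 1)) ^ (n - i) * (r / (r + 1)) ^ (k - i) * (m / (r + 1)\<^sup>2) ^ i))"

end

theory Submission
  imports Defs
begin

text \<open>Given \<open>X = n\<close>, the variable \<open>(m, r) \<odot> X\<close> is a sum of \<open>n\<close> independent variables with generating
function \<open>psi m r\<close>. Two ideas make this precise and computable.

Conditioning is done by freezing (\<open>nn_cond_exp_freeze\<close>): if each \<open>W n\<close> is independent of \<open>X\<close>, then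
the conditional expectation of \<open>g X (W X)\<close> given \<open>X\<close> is the function \<open>n \<mapsto> E (g n (W n))\<close> evaluated
at \<open>X\<close>. With partial sums of \<open>Z\<close> for \<open>W\<close> and suitable choices of \<open>g\<close>, all the conditional statements
reduce to statements about a sum of a fixed number \<open>n\<close> of terms, and the unconditional moments follow
by integrating over \<open>X\<close>.

Distributions are found from generating functions, since these determine the probabilities
(\<open>prob_eq_of_pgf_sums\<close>). With \<open>q = r / (r + 1)\<close>, one has
\<open>psi m r s = (1 - m / (r + 1)) + m / (r + 1)\<^sup>2 * s / (1 - q * s)\<close>: a summand is \<open>0\<close> with probability
\<open>1 - m / (r + 1)\<close> and otherwise geometric on \<open>{1, 2, \<dots>}\<close>. The binomial theorem and the negative
binomial series expand the \<open>n\<close>-th power of this, and the coefficients are \<open>thin_mass m r n k\<close>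
(\<open>thin_mass_sums\<close>). The case \<open>n = 1\<close> also yields the moments of a summand, and independence those of
the sum.

For the additivity property, freezing shows that the generating function of \<open>(m, r) \<odot> X\<close> at \<open>s\<close> is
\<open>E (psi m r s ^ X)\<close>. This expression turns a sum of independent variables \<open>X + Y\<close> into a product, and
the generating function of a sum of independent thinned variables is a product as well.\<close>

section \<open>Generating functions of natural-number valued variables\<close>

text \<open>The point is that vanishing is known only to the right of \<open>0\<close>, which is all that a generating
function on \<open>[0,1]\<close> provides. Once the coefficients below \<open>n\<close> vanish, dividing by \<open>x ^ n\<close> leaves
a series that still vanishes there and tends to \<open>a n\<close> at \<open>0\<close>.\<close>

lemma powser_eq_0_imp_coeff_0:
  fixes a :: "nat \<Rightarrow> real"
  assumes zero: "\<And>x. 0 < x \<Longrightarrow> x < R \<Longrightarrow> (\<lambda>n. a n * x ^ n) sums 0" and "R > 0"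
  shows "a n = 0"
proof (induction n rule: less_induct)
  case (less n)
  define \<rho> where "\<rho> = R / 2"
  have \<rho>: "0 < \<rho>" "\<rho> < R" using \<open>R > 0\<close> by (auto simp: \<rho>_def)
  have shifted: "(\<lambda>k. a (k + n) * x ^ k) sums 0" if "0 < x" "x < R" for x
  proof -
    have "(\<lambda>k. a (k + n) * x ^ (k + n)) sums (0 - (\<Sum>i<n. a i * x ^ i))"
      using zero[OF that] by (subst sums_iff_shift) simp
    also have "(\<Sum>i<n. a i * x ^ i) = 0"
      using less.IH by (intro sum.neutral) simp
    finally have "(\<lambda>k. a (k + n) * x ^ (k + n) / x ^ n) sums (0 / x ^ n)"
      by (intro sums_divide) simp
    then show ?thesis using that by (simp add: power_add)
  qed
  have "summable (\<lambda>k. a (k + n) * x ^ k)" if "norm x < \<rho>" for x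
    using shifted[OF \<rho>] that \<rho> by (intro powser_inside[OF sums_summable, of _ \<rho>]) auto
  then have "((\<lambda>x. \<Sum>k. a (k + n) * x ^ k) \<longlongrightarrow> a (0 + n)) (at 0)"
    by (intro powser_limit_0[of \<rho> "\<lambda>k. a (k + n)"] summable_sums) (auto simp: \<rho>)
  then have "((\<lambda>x. \<Sum>k. a (k + n) * x ^ k) \<longlongrightarrow> a n) (at_right 0)"
    by (auto intro: tendsto_mono[OF at_le])
  moreover have "eventually (\<lambda>x. 0 = (\<Sum>k. a (k + n) * x ^ k)) (at_right 0)"
    using eventually_at_right_real[OF \<open>R > 0\<close>]
    by (rule eventually_mono) (simp add: sums_unique[OF shifted, symmetric])
  ultimately have "((\<lambda>x. 0) \<longlongrightarrow> a n) (at_right (0::real))"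
    by (rule Lim_transform_eventually[OF _ eventually_mono]) auto
  then show ?case by (simp add: tendsto_const_iff)
qed

lemma nn_integral_nat_valued:
  assumes [measurable]: "V \<in> measurable M nat_space"
  shows "(\<integral>\<^sup>+\<omega>. g (V \<omega>) \<partial>M) = (\<Sum>k. g k * emeasure M {\<omega> \<in> space M. V \<omega> = k})"
proof -
  have "g (V \<omega>) = (\<Sum>k. g k * indicator {\<omega> \<in> space M. V \<omega> = k} \<omega>)"
    if "\<omega> \<in> space M" for \<omega>
    using that by (subst suminf_finite[of "{V \<omega>}"]) (auto simp: indicator_def)
  then have "(\<integral>\<^sup>+\<omega>. g (V \<omega>) \<partial>M) =
      (\<integral>\<^sup>+\<omega>. (\<Sum>k. g k * indicator {\<omega> \<in> space M. V \<omega> = k} \<omega>) \<partial>M)"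
    by (intro nn_integral_cong)
  also have "\<dots> = (\<Sum>k. \<integral>\<^sup>+\<omega>. g k * indicator {\<omega> \<in> space M. V \<omega> = k} \<omega> \<partial>M)"
    by (intro nn_integral_suminf) measurable
  also have "\<dots> = (\<Sum>k. g k * emeasure M {\<omega> \<in> space M. V \<omega> = k})"
    by (intro suminf_cong nn_integral_cmult_indicator) measurable
  finally show ?thesis .
qed

lemma distr_nat_eqI:
  assumes "V \<in> measurable M nat_space" "W \<in> measurable M nat_space"
    and "\<And>k. emeasure M {\<omega> \<in> space M. V \<omega> = k} = emeasure M {\<omega> \<in> space M. W \<omega> = k}"
  shows "distr M nat_space V = distr M nat_space W"
proof (rule measure_eqI_countable[of _ UNIV])
  fix k :: nat assume "k \<in> UNIV"
  show "emeasure (distr M nat_space V) {k} = emeasure (distr M nat_space W) {k}"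
    using assms by (simp add: emeasure_distr vimage_def Collect_conj_eq Int_commute)
qed auto

context prob_space
begin

lemma integrable_power_bounded_base:
  assumes [measurable]: "random_variable nat_space V" and "0 \<le> s" "s \<le> 1"
  shows "integrable M (\<lambda>\<omega>. s ^ V \<omega> :: real)"
  using assms by (intro integrable_const_bound[of _ 1]) (auto intro: power_le_one)

lemma pgf_sums:
  assumes V[measurable]: "random_variable nat_space V" and s: "0 \<le> s" "s \<le> 1"
  shows "(\<lambda>k. prob {\<omega> \<in> space M. V \<omega> = k} * s ^ k) sums (\<integral>\<omega>. s ^ V \<omega> \<partial>M)"
proof -
  have "integrable M (\<lambda>\<omega>. s ^ V \<omega>)"
    using V s by (rule integrable_power_bounded_base)
  then have "ennreal (\<integral>\<omega>. s ^ V \<omega> \<partial>M) = (\<integral>\<^sup>+\<omega>. ennreal (s ^ V \<omega>) \<partial>M)"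
    using s by (simp add: nn_integral_eq_integral)
  also have "\<dots> = (\<Sum>k. ennreal (s ^ k) * emeasure M {\<omega> \<in> space M. V \<omega> = k})"
    by (rule nn_integral_nat_valued) measurable
  also have "\<dots> = (\<Sum>k. ennreal (prob {\<omega> \<in> space M. V \<omega> = k} * s ^ k))"
    using s by (simp add: emeasure_eq_measure ennreal_mult mult.commute)
  finally have "(\<Sum>k. ennreal (prob {\<omega> \<in> space M. V \<omega> = k} * s ^ k))
      = ennreal (\<integral>\<omega>. s ^ V \<omega> \<partial>M)" ..
  then have "(\<lambda>k. ennreal (prob {\<omega> \<in> space M. V \<omega> = k} * s ^ k))
      sums ennreal (\<integral>\<omega>. s ^ V \<omega> \<partial>M)"
    by (simp add: sums_iff)
  then show ?thesis using s
    by (subst (asm) sums_ennreal) auto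
qed

text \<open>With \<open>p\<close> the coefficients of a closed form, this computes a distribution; with \<open>p\<close> the probabilities
of another variable, it shows that two distributions agree.\<close>

lemma prob_eq_of_pgf_sums:
  assumes V: "random_variable nat_space V"
    and p: "\<And>s. 0 < s \<Longrightarrow> s < 1 \<Longrightarrow> (\<lambda>k. p k * s ^ k) sums (\<integral>\<omega>. s ^ V \<omega> \<partial>M)"
  shows "prob {\<omega> \<in> space M. V \<omega> = k} = p k"
proof -
  have "prob {\<omega> \<in> space M. V \<omega> = k} - p k = 0"
  proof (rule powser_eq_0_imp_coeff_0[of 1])
    fix s :: real assume "0 < s" "s < 1"
    then show "(\<lambda>k. (prob {\<omega> \<in> space M. V \<omega> = k} - p k) * s ^ k) sums 0"
      using sums_diff[OF pgf_sums[OF V, of s] p[of s]] by (simp add: left_diff_distrib)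
  qed simp
  then show ?thesis by simp
qed

lemma integral_nat_valued:
  assumes V[measurable]: "random_variable nat_space V" and g: "\<And>k. 0 \<le> g k"
    and L: "(\<lambda>k. g k * prob {\<omega> \<in> space M. V \<omega> = k}) sums L"
  shows "integrable M (\<lambda>\<omega>. g (V \<omega>))" "(\<integral>\<omega>. g (V \<omega>) \<partial>M) = L"
proof -
  have "L \<ge> 0" using sums_le[OF _ sums_zero L] g by simp
  have "(\<integral>\<^sup>+\<omega>. ennreal (g (V \<omega>)) \<partial>M)
      = (\<Sum>k. ennreal (g k) * emeasure M {\<omega> \<in> space M. V \<omega> = k})"
    by (rule nn_integral_nat_valued) measurable
  also have "\<dots> = (\<Sum>k. ennreal (g k * prob {\<omega> \<in> space M. V \<omega> = k}))"
    using g by (simp add: emeasure_eq_measure ennreal_mult)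
  also have "\<dots> = ennreal L"
    using L g by (intro suminf_ennreal_eq) auto
  finally have *: "(\<integral>\<^sup>+\<omega>. ennreal (g (V \<omega>)) \<partial>M) = ennreal L" .
  then show "integrable M (\<lambda>\<omega>. g (V \<omega>))"
    using g by (intro integrableI_nonneg) auto
  then show "(\<integral>\<omega>. g (V \<omega>) \<partial>M) = L"
    using * g \<open>L \<ge> 0\<close> by (simp add: nn_integral_eq_integral)
qed

end

section \<open>Power series expansion of the powers of \<open>psi\<close>\<close>

text \<open>This is the binomial series with exponent \<open>- Suc i\<close>, whose coefficients are
\<open>(-1) ^ j * binom (i + j) j\<close>.\<close>

lemma negative_binomial_series:
  fixes x :: real
  assumes "\<bar>x\<bar> < 1"
  shows "(\<lambda>j. real ((i + j) choose i) * x ^ j) sums (1 / (1 - x) ^ Suc i)"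
proof -
  have eq: "((- real (Suc i)) gchoose j) * (- x) ^ j = real ((i + j) choose i) * x ^ j" for j
  proof -
    have "((- real (Suc i)) gchoose j) = (-1) ^ j * (real (i + j) gchoose j)"
      unfolding gbinomial_minus by (simp add: add_ac)
    also have "real (i + j) gchoose j = real ((i + j) choose i)"
      using binomial_symmetric[of i "i + j"] by (simp flip: binomial_gbinomial of_nat_add)
    finally show ?thesis
      by (simp add: power_mult_distrib[symmetric] mult_ac flip: mult.assoc)
  qed
  have "(\<lambda>j. ((- real (Suc i)) gchoose j) * (- x) ^ j) sums (1 + - x) powr (- real (Suc i))"
    using assms by (intro gen_binomial_real) simp
  also have "(1 + - x) powr (- real (Suc i)) = 1 / (1 - x) ^ Suc i"
    using assms by (simp only: powr_minus_divide powr_realpow) simp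
  finally show ?thesis unfolding eq .
qed

text \<open>The coefficient of \<open>s ^ k\<close> in \<open>(s / (1 - q * s)) ^ i\<close>. Up to the factor \<open>(1 - q) ^ i\<close> this is the
probability that \<open>i\<close> independent geometric variables with values in \<open>{1, 2, \<dots>}\<close> add up to \<open>k\<close>;
\<open>k = 0\<close> is possible only for the empty sum.\<close>

definition geometric_sum_coeff :: "real \<Rightarrow> nat \<Rightarrow> nat \<Rightarrow> real" where
  "geometric_sum_coeff q i k =
     (if k = 0 then of_bool (i = 0) else real (choose_pred k i) * q ^ (k - i))"

lemma geometric_sum_coeff_sums:
  assumes "\<bar>q * s\<bar> < 1"
  shows "(\<lambda>k. geometric_sum_coeff q i k * s ^ k) sums (s / (1 - q * s)) ^ i"
proof (cases i)
  case 0
  then have "(\<lambda>k. geometric_sum_coeff q i k * s ^ k) = (\<lambda>k. if k = 0 then 1 else 0)"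
    by (auto simp: geometric_sum_coeff_def choose_pred_def fun_eq_iff)
  then show ?thesis using 0 sums_single[of 0 "\<lambda>_. 1 :: real"] by simp
next
  case (Suc l)
  have "(\<lambda>j. s ^ i * (real ((l + j) choose l) * (q * s) ^ j))
      sums (s ^ i * (1 / (1 - q * s) ^ Suc l))"
    by (intro sums_mult negative_binomial_series assms)
  moreover have "s ^ i * (real ((l + j) choose l) * (q * s) ^ j)
      = geometric_sum_coeff q i (j + i) * s ^ (j + i)" for j
    using Suc by (simp add: geometric_sum_coeff_def choose_pred_def power_add
        power_mult_distrib add.commute)
  moreover have "s ^ i * (1 / (1 - q * s) ^ Suc l) = (s / (1 - q * s)) ^ i"
    using Suc by (simp add: power_divide)
  ultimately have "(\<lambda>j. geometric_sum_coeff q i (j + i) * s ^ (j + i))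
      sums (s / (1 - q * s)) ^ i"
    by (simp only:)
  moreover have "geometric_sum_coeff q i k * s ^ k = 0" if "k < i" for k
    using that Suc by (auto simp: geometric_sum_coeff_def choose_pred_def)
  ultimately show ?thesis
    using sums_zero_iff_shift[of i "\<lambda>k. geometric_sum_coeff q i k * s ^ k"] by blast
qed

text \<open>One formula covers all the cases in the definition of \<open>thin_mass\<close>, boundary of the parameter region
included. It reads as a binomial mixture: \<open>i\<close> of the \<open>n\<close> summands are positive, each of them
geometric, and \<open>m / (r + 1)\<^sup>2\<close> is the probability \<open>m / (r + 1)\<close> of being positive times the
geometric parameter \<open>1 / (r + 1)\<close>.\<close>

lemma thin_mass_eq:
  assumes "(m, r) \<in> param_region"
  shows "thin_mass m r n k =
    (\<Sum>i\<le>n. real (n choose i) * (m / (r + 1)\<^sup>2) ^ i * (1 - m / (r + 1)) ^ (n - i) *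
        geometric_sum_coeff (r / (r + 1)) i k)"
proof (cases "k = 0")
  case True
  have "(\<Sum>i\<le>n. real (n choose i) * (m / (r + 1)\<^sup>2) ^ i * (1 - m / (r + 1)) ^ (n - i) *
        of_bool (i = 0)) = (\<Sum>i\<le>n. if i = 0 then (1 - m / (r + 1)) ^ n else 0)"
    by (intro sum.cong) auto
  with True show ?thesis
    by (simp add: geometric_sum_coeff_def thin_mass_def)
next
  case False
  have r: "r \<ge> 0" using assms by (simp add: param_region_def)
  let ?t = "\<lambda>i. real (n choose i) * (m / (r + 1)\<^sup>2) ^ i * (1 - m / (r + 1)) ^ (n - i) *
        geometric_sum_coeff (r / (r + 1)) i k"
  have "thin_mass m r n k = (\<Sum>i = 0..min k n. ?t i)"
  proof (cases "r \<noteq> 0 \<and> m \<noteq> r + 1")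
    case True
    have "(1 - m / (r + 1)) ^ n * (r / (r + 1)) ^ k * (m / (r * (r + 1 - m))) ^ i
        = (m / (r + 1)\<^sup>2) ^ i * (1 - m / (r + 1)) ^ (n - i) * (r / (r + 1)) ^ (k - i)"
      if "i \<le> min k n" for i
    proof -
      have "(1 - m / (r + 1)) * (r / (r + 1)) * (m / (r * (r + 1 - m))) = m / (r + 1)\<^sup>2"
        using True r by (simp add: divide_simps power2_eq_square)
      then have "(m / (r + 1)\<^sup>2) ^ i = (1 - m / (r + 1)) ^ i * (r / (r + 1)) ^ i
          * (m / (r * (r + 1 - m))) ^ i"
        by (metis power_mult_distrib)
      moreover have "(1 - m / (r + 1)) ^ n = (1 - m / (r + 1)) ^ (n - i) * (1 - m / (r + 1)) ^ i"
        "(r / (r + 1)) ^ k = (r / (r + 1)) ^ (k - i) * (r / (r + 1)) ^ i"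
        using that by (simp_all flip: power_add)
      ultimately show ?thesis by simp
    qed
    then show ?thesis
      using True False
      by (auto simp: thin_mass_def geometric_sum_coeff_def sum_distrib_left mult_ac
          intro!: sum.cong)
  next
    case deg: False
    show ?thesis
      unfolding thin_mass_def geometric_sum_coeff_def if_not_P[OF False] if_not_P[OF deg]
      by (simp add: mult_ac)
  qed
  also have "\<dots> = (\<Sum>i\<le>n. ?t i)"
    using False by (intro sum.mono_neutral_left)
      (auto simp: geometric_sum_coeff_def choose_pred_def)
  finally show ?thesis .
qed

text \<open>Summing over \<open>k\<close> first turns the mixture into the binomial expansion of
\<open>(b * s / (1 - q * s) + a) ^ n\<close> with \<open>q = r / (r + 1)\<close>, and the base is the partial fraction
decomposition of \<open>psi m r s\<close>.\<close>

lemma thin_mass_sums: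
  assumes mr: "(m, r) \<in> param_region" and s: "0 \<le> s" "s \<le> 1"
  shows "(\<lambda>k. thin_mass m r n k * s ^ k) sums (psi m r s ^ n)"
proof -
  let ?a = "1 - m / (r + 1)" and ?b = "m / (r + 1)\<^sup>2" and ?q = "r / (r + 1)"
  have r: "r \<ge> 0" using mr by (simp add: param_region_def)
  have "?q * s \<le> ?q * 1" using r s by (intro mult_left_mono) auto
  also have "?q * 1 < 1" using r by simp
  finally have "?q * s < 1" .
  moreover have "0 \<le> ?q * s" using r s by simp
  ultimately have qs_abs: "\<bar>?q * s\<bar> < 1" by (simp only: abs_of_nonneg)
  have rs: "r * s \<le> r" using r s by (simp add: mult_left_le)
  have "(\<lambda>k. \<Sum>i\<le>n. real (n choose i) * ?b ^ i * ?a ^ (n - i) * (geometric_sum_coeff ?q i k * s ^ k))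
      sums (\<Sum>i\<le>n. real (n choose i) * ?b ^ i * ?a ^ (n - i) * (s / (1 - ?q * s)) ^ i)"
    using qs_abs by (intro sums_sum sums_mult geometric_sum_coeff_sums)
  also have "(\<Sum>i\<le>n. real (n choose i) * ?b ^ i * ?a ^ (n - i) * (s / (1 - ?q * s)) ^ i)
      = (?b * (s / (1 - ?q * s)) + ?a) ^ n"
    unfolding binomial_ring by (simp only: power_mult_distrib mult_ac)
  also have "?b * (s / (1 - ?q * s)) + ?a = psi m r s"
  proof -
    define d where "d = 1 + r * (1 - s)"
    have d: "d > 0" "r * s = 1 + r - d" using rs by (auto simp: d_def algebra_simps)
    have "1 - ?q * s = d / (r + 1)" using r d by (simp add: divide_simps)
    then have "?b * (s / (1 - ?q * s)) = m * s / ((r + 1) * d)"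
      using r d by (simp add: divide_simps power2_eq_square)
    also have "m * s / ((r + 1) * d) + ?a = 1 - m * ((1 - s) / d)"
    proof -
      have "s - d = - ((r + 1) * (1 - s))" by (simp add: d_def algebra_simps)
      have "m * s / ((r + 1) * d) - m / (r + 1) = m * (s - d) / ((r + 1) * d)"
        using r d by (simp add: divide_simps) (simp add: algebra_simps)
      also have "\<dots> = - (m * ((1 - s) / d))"
        unfolding \<open>s - d = _\<close> using r d by (simp add: divide_simps)
      finally show ?thesis by simp
    qed
    finally show ?thesis by (simp add: psi_def d_def)
  qed
  finally show ?thesis
    by (simp add: thin_mass_eq[OF mr] sum_distrib_right mult.assoc)
qed

lemma thin_mass_1_Suc:
  assumes "(m, r) \<in> param_region"
  shows "thin_mass m r 1 (Suc k) = m / (r + 1)\<^sup>2 * (r / (r + 1)) ^ k"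
  by (simp add: thin_mass_eq[OF assms] geometric_sum_coeff_def choose_pred_def)

section \<open>Conditioning on one of two independent variables\<close>

lemma (in sigma_finite_subalgebra) real_cond_exp_nonneg:
  assumes [measurable]: "f \<in> borel_measurable M" and "\<And>\<omega>. 0 \<le> f \<omega>"
  shows "AE \<omega> in M. real_cond_exp M F f \<omega>
    = enn2real (nn_cond_exp M F (\<lambda>\<eta>. ennreal (f \<eta>)) \<omega>)"
proof -
  have "(\<lambda>\<omega>. ennreal (- f \<omega>)) = (\<lambda>_. 0)"
    using assms by (simp add: ennreal_neg)
  moreover have "AE \<omega> in M. 0 = nn_cond_exp M F (\<lambda>_. 0) \<omega>"
    by (intro nn_cond_exp_F_meas) simp
  ultimately show ?thesis
    by (auto simp: real_cond_exp_def)
qed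

context prob_space
begin

lemma indep_var_nn_integral:
  assumes ind: "indep_var S U T V"
    and [measurable]: "u \<in> borel_measurable S" "v \<in> borel_measurable T"
  shows "(\<integral>\<^sup>+\<omega>. u (U \<omega>) * v (V \<omega>) \<partial>M) = (\<integral>\<^sup>+\<omega>. u (U \<omega>) \<partial>M) * (\<integral>\<^sup>+\<omega>. v (V \<omega>) \<partial>M)"
proof -
  have [measurable]: "U \<in> measurable M S" "V \<in> measurable M T"
    using indep_var_rv1[OF ind] indep_var_rv2[OF ind] by auto
  interpret V: prob_space "distr M T V" by (rule prob_space_distr) measurable
  have "(\<integral>\<^sup>+\<omega>. u (U \<omega>) * v (V \<omega>) \<partial>M)
      = (\<integral>\<^sup>+p. u (fst p) * v (snd p) \<partial>distr M (S \<Otimes>\<^sub>M T) (\<lambda>\<omega>. (U \<omega>, V \<omega>)))"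
    by (simp add: nn_integral_distr)
  also have "distr M (S \<Otimes>\<^sub>M T) (\<lambda>\<omega>. (U \<omega>, V \<omega>)) = distr M S U \<Otimes>\<^sub>M distr M T V"
    using ind by (simp add: indep_var_distribution_eq)
  also have "(\<integral>\<^sup>+p. u (fst p) * v (snd p) \<partial>(distr M S U \<Otimes>\<^sub>M distr M T V))
      = (\<integral>\<^sup>+x. \<integral>\<^sup>+y. u x * v y \<partial>distr M T V \<partial>distr M S U)"
    by (subst V.nn_integral_fst[symmetric]) auto
  also have "\<dots> = (\<integral>\<^sup>+x. u x \<partial>distr M S U) * (\<integral>\<^sup>+y. v y \<partial>distr M T V)"
    by (simp add: nn_integral_cmult nn_integral_multc)
  finally show ?thesis by (simp add: nn_integral_distr)
qed

text \<open>Since \<open>X\<close> takes countably many values, the integral splits over the events \<open>X = n\<close>. On each of them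
the inner variable is the fixed \<open>W n\<close>, and independence separates the indicator of the event from
it.\<close>

lemma nn_integral_freeze:
  assumes ind: "\<And>n. indep_var nat_space X nat_space (W n)"
  shows "(\<integral>\<^sup>+\<omega>. g (X \<omega>) (W (X \<omega>) \<omega>) \<partial>M)
    = (\<integral>\<^sup>+\<omega>. (\<integral>\<^sup>+\<eta>. g (X \<omega>) (W (X \<omega>) \<eta>) \<partial>M) \<partial>M)"
proof -
  have X[measurable]: "X \<in> measurable M nat_space" and [measurable]: "W n \<in> measurable M nat_space" for n
    using indep_var_rv1[OF ind] indep_var_rv2[OF ind] by auto
  have ind_meas: "(\<lambda>\<omega>. indicator {n} (X \<omega>) :: ennreal) \<in> borel_measurable M" for n
    by (rule measurable_compose[OF X]) simp
  have decomp: "(\<integral>\<^sup>+\<omega>. f (X \<omega>) \<omega> \<partial>M) = (\<Sum>n. \<integral>\<^sup>+\<omega>. indicator {n} (X \<omega>) * f n \<omega> \<partial>M)"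
    if "\<And>n. f n \<in> borel_measurable M" for f :: "nat \<Rightarrow> 'a \<Rightarrow> ennreal"
  proof -
    have "f (X \<omega>) \<omega> = (\<Sum>n. indicator {n} (X \<omega>) * f n \<omega>)" for \<omega>
      by (subst suminf_finite[of "{X \<omega>}"]) auto
    then have "(\<integral>\<^sup>+\<omega>. f (X \<omega>) \<omega> \<partial>M) = (\<integral>\<^sup>+\<omega>. (\<Sum>n. indicator {n} (X \<omega>) * f n \<omega>) \<partial>M)"
      by simp
    also have "\<dots> = (\<Sum>n. \<integral>\<^sup>+\<omega>. indicator {n} (X \<omega>) * f n \<omega> \<partial>M)"
      by (intro nn_integral_suminf borel_measurable_times_ennreal ind_meas that)
    finally show ?thesis .
  qed
  have "(\<integral>\<^sup>+\<omega>. g (X \<omega>) (W (X \<omega>) \<omega>) \<partial>M)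
      = (\<Sum>n. \<integral>\<^sup>+\<omega>. indicator {n} (X \<omega>) * g n (W n \<omega>) \<partial>M)"
    by (rule decomp) measurable
  also have "\<dots> = (\<Sum>n. \<integral>\<^sup>+\<omega>. indicator {n} (X \<omega>) * (\<integral>\<^sup>+\<eta>. g n (W n \<eta>) \<partial>M) \<partial>M)"
    by (intro suminf_cong, subst indep_var_nn_integral[OF ind]) (simp_all add: nn_integral_multc ind_meas)
  also have "\<dots> = (\<integral>\<^sup>+\<omega>. (\<integral>\<^sup>+\<eta>. g (X \<omega>) (W (X \<omega>) \<eta>) \<partial>M) \<partial>M)"
    by (rule decomp[symmetric]) measurable
  finally show ?thesis .
qed

lemma sigma_finite_subalgebra_sigma_gen:
  assumes [measurable]: "random_variable nat_space X"
  shows "sigma_finite_subalgebra M (sigma_gen M X)"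
proof (rule finite_measure_subalgebra_is_sigma_finite)
  show "finite_measure_subalgebra M (sigma_gen M X)"
    by unfold_locales
      (auto simp: subalgebra_def sigma_gen_def sets_vimage_algebra2 intro: measurable_sets[OF assms])
qed

text \<open>Conditioning on \<open>X\<close> freezes its value and averages over the rest. The events of \<open>\<sigma>(X)\<close> have the form
\<open>X \<in> B\<close>, so the defining property of the conditional expectation is
\<open>nn_integral_freeze\<close> for the integrand multiplied by the indicator of \<open>B\<close>.\<close>

lemma nn_cond_exp_freeze:
  assumes ind: "\<And>n. indep_var nat_space X nat_space (W n)"
  shows "AE \<omega> in M. nn_cond_exp M (sigma_gen M X) (\<lambda>\<eta>. g (X \<eta>) (W (X \<eta>) \<eta>)) \<omega>
    = (\<integral>\<^sup>+\<eta>. g (X \<omega>) (W (X \<omega>) \<eta>) \<partial>M)"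
proof -
  have X[measurable]: "X \<in> measurable M nat_space" and [measurable]: "W n \<in> measurable M nat_space" for n
    using indep_var_rv1[OF ind] indep_var_rv2[OF ind] by auto
  interpret sigma_finite_subalgebra M "sigma_gen M X"
    by (rule sigma_finite_subalgebra_sigma_gen[OF X])
  have "AE \<omega> in M. (\<integral>\<^sup>+\<eta>. g (X \<omega>) (W (X \<omega>) \<eta>) \<partial>M)
    = nn_cond_exp M (sigma_gen M X) (\<lambda>\<eta>. g (X \<eta>) (W (X \<eta>) \<eta>)) \<omega>"
  proof (rule nn_cond_exp_charact)
    fix A assume "A \<in> sets (sigma_gen M X)"
    then obtain B where B: "A = X -` B \<inter> space M"
      by (auto simp: sigma_gen_def sets_vimage_algebra2)
    have ind_A: "indicator A \<omega> = (indicator B (X \<omega>) :: ennreal)" if "\<omega> \<in> space M" for \<omega>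
      using that by (simp add: B indicator_def)
    have "(\<integral>\<^sup>+\<omega>\<in>A. g (X \<omega>) (W (X \<omega>) \<omega>) \<partial>M)
        = (\<integral>\<^sup>+\<omega>. g (X \<omega>) (W (X \<omega>) \<omega>) * indicator B (X \<omega>) \<partial>M)"
      by (intro nn_integral_cong) (simp add: ind_A)
    also have "\<dots> = (\<integral>\<^sup>+\<omega>. (\<integral>\<^sup>+\<eta>. g (X \<omega>) (W (X \<omega>) \<eta>) * indicator B (X \<omega>) \<partial>M) \<partial>M)"
      by (rule nn_integral_freeze[OF ind, where g = "\<lambda>n t. g n t * indicator B n"])
    also have "\<dots> = (\<integral>\<^sup>+\<omega>\<in>A. (\<integral>\<^sup>+\<eta>. g (X \<omega>) (W (X \<omega>) \<eta>) \<partial>M) \<partial>M)"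
      by (intro nn_integral_cong) (simp add: ind_A nn_integral_multc)
    finally show "(\<integral>\<^sup>+\<omega>\<in>A. g (X \<omega>) (W (X \<omega>) \<omega>) \<partial>M)
        = (\<integral>\<^sup>+\<omega>\<in>A. (\<integral>\<^sup>+\<eta>. g (X \<omega>) (W (X \<omega>) \<eta>) \<partial>M) \<partial>M)" .
  next
    show "(\<lambda>\<eta>. g (X \<eta>) (W (X \<eta>) \<eta>)) \<in> borel_measurable M"
      by (rule measurable_compose_countable[where f = "\<lambda>n \<eta>. g n (W n \<eta>)"]) measurable
    have "X \<in> measurable (sigma_gen M X) nat_space"
      unfolding sigma_gen_def by (rule measurable_vimage_algebra1) simp
    then show "(\<lambda>\<omega>. \<integral>\<^sup>+\<eta>. g (X \<omega>) (W (X \<omega>) \<eta>) \<partial>M) \<in> borel_measurable (sigma_gen M X)"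
      by (rule measurable_compose[where g = "\<lambda>n. \<integral>\<^sup>+\<eta>. g n (W n \<eta>) \<partial>M"]) simp
  qed
  then show ?thesis by (rule AE_mp) (auto intro!: AE_I2)
qed

text \<open>A function of \<open>V\<close> generates a smaller \<open>\<sigma>\<close>-algebra than \<open>V\<close>. The function maps the second variable
into the value type of the first, so that \<open>indep_var\<close> can express the result.\<close>

lemma indep_rv_compose_indep_var:
  assumes ind: "indep_rv M S U T V" and g[measurable]: "g \<in> measurable T S'"
  shows "indep_var S U S' (\<lambda>\<omega>. g (V \<omega>))"
  unfolding indep_var_eq
proof (intro conjI)
  have U: "U \<in> measurable M S" and V[measurable]: "V \<in> measurable M T"
    using ind by (auto simp: indep_rv_def)
  show "random_variable S U" "random_variable S' (\<lambda>\<omega>. g (V \<omega>))"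
    using U by measurable
  let ?FV = "vimage_algebra (space M) V T"
  have "V \<in> measurable ?FV T"
    using measurable_space[OF V] by (intro measurable_vimage_algebra1) auto
  from measurable_compose[OF this g]
  have "{(\<lambda>\<omega>. g (V \<omega>)) -` A \<inter> space M |A. A \<in> sets S'} \<subseteq> sets ?FV"
    by (auto dest: measurable_sets)
  then have "sigma_sets (space M) {(\<lambda>\<omega>. g (V \<omega>)) -` A \<inter> space M |A. A \<in> sets S'} \<subseteq> sets ?FV"
    using sets.sigma_sets_subset[of _ ?FV] by simp
  moreover have "indep_set (sets (vimage_algebra (space M) U S)) (sets ?FV)"
    using ind by (simp add: indep_rv_def)
  ultimately show "indep_set (sigma_sets (space M) {U -` A \<inter> space M |A. A \<in> sets S})
      (sigma_sets (space M) {(\<lambda>\<omega>. g (V \<omega>)) -` A \<inter> space M |A. A \<in> sets S'})"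
    unfolding indep_sets2_eq sets_vimage_algebra by blast
qed

end

section \<open>Sums of a fixed number of terms\<close>

locale iid_psi_sequence = prob_space +
  fixes m r :: real and Z :: "nat \<Rightarrow> 'a \<Rightarrow> nat"
  assumes param: "(m, r) \<in> param_region"
    and indep_Z: "indep_vars (\<lambda>_. nat_space) Z UNIV"
    and pgf_Z: "has_pgf M (Z i) (psi m r)"
begin

lemma measurable_Z [measurable]: "random_variable nat_space (Z i)"
  using indep_Z by (simp add: indep_vars_def)

lemma m_pos: "m > 0" and r_nonneg: "r \<ge> 0" and variance_factor_nonneg: "m * (2 * r + 1 - m) \<ge> 0"
  using param by (auto simp: param_region_def)

lemma expectation_power_Z:
  assumes "0 \<le> s" "s \<le> 1"
  shows "expectation (\<lambda>\<omega>. s ^ Z i \<omega>) = psi m r s"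
  using pgf_Z assms by (simp add: has_pgf_def)

lemma psi_nonneg: "0 \<le> s \<Longrightarrow> s \<le> 1 \<Longrightarrow> 0 \<le> psi m r s"
  unfolding expectation_power_Z[of _ 0, symmetric] by (rule Bochner_Integration.integral_nonneg) simp

lemma psi_le_1: "0 \<le> s \<Longrightarrow> s \<le> 1 \<Longrightarrow> psi m r s \<le> 1"
  using m_pos r_nonneg by (simp add: psi_def)

lemma expectation_power_partial_sum:
  assumes "0 \<le> s" "s \<le> 1"
  shows "expectation (\<lambda>\<omega>. s ^ (\<Sum>i<n. Z i \<omega>)) = psi m r s ^ n"
proof -
  have "indep_vars (\<lambda>_. borel) (\<lambda>i \<omega>. s ^ Z i \<omega>) {..<n}"
    by (rule indep_vars_compose2[OF indep_vars_subset[OF indep_Z]]) auto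
  then have "expectation (\<lambda>\<omega>. \<Prod>i<n. s ^ Z i \<omega>) = (\<Prod>i<n. expectation (\<lambda>\<omega>. s ^ Z i \<omega>))"
    using assms by (intro indep_vars_lebesgue_integral integrable_power_bounded_base) auto
  then show ?thesis using assms by (simp add: power_sum expectation_power_Z)
qed

text \<open>The generating function of the sum is \<open>psi m r s ^ n\<close>, whose expansion is known.\<close>

lemma prob_partial_sum:
  "prob {\<omega> \<in> space M. (\<Sum>i<n. Z i \<omega>) = k} = thin_mass m r n k"
  by (rule prob_eq_of_pgf_sums)
     (auto simp: expectation_power_partial_sum intro!: thin_mass_sums param)

lemma prob_Z: "prob {\<omega> \<in> space M. Z i \<omega> = k} = thin_mass m r 1 k"
  by (rule prob_eq_of_pgf_sums)
     (use thin_mass_sums[OF param, of _ 1] in \<open>auto simp: expectation_power_Z\<close>)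

text \<open>A single summand has mass \<open>b * q ^ j\<close> at \<open>Suc j\<close>, so both moments are values of negative binomial
series at \<open>q\<close>; for the second, \<open>(j + 1)\<^sup>2 = 2 * binom (j + 2) 2 - (j + 1)\<close>.\<close>

lemma expectation_Z:
  "integrable M (\<lambda>\<omega>. real (Z i \<omega>))" "expectation (\<lambda>\<omega>. real (Z i \<omega>)) = m"
  and expectation_Z_square:
  "integrable M (\<lambda>\<omega>. (real (Z i \<omega>))\<^sup>2)" "expectation (\<lambda>\<omega>. (real (Z i \<omega>))\<^sup>2) = (2 * r + 1) * m"
proof -
  define b where "b = m / (r + 1)\<^sup>2"
  define q where "q = r / (r + 1)"
  have q: "\<bar>q\<bar> < 1" "1 - q = 1 / (r + 1)"
    using r_nonneg by (auto simp: q_def divide_simps)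
  have r1: "r + 1 \<noteq> 0" using r_nonneg by simp
  have first: "(\<lambda>j. real (Suc j) * q ^ j) sums (r + 1)\<^sup>2"
    using negative_binomial_series[OF q(1), of 1] by (simp add: q(2) power2_eq_square)
  have second: "(\<lambda>j. real (Suc (Suc j) choose 2) * q ^ j) sums (r + 1) ^ 3"
    using negative_binomial_series[OF q(1), of 2] by (simp add: q(2) power3_eq_cube)
  have mass: "prob {\<omega> \<in> space M. Z i \<omega> = Suc j} = b * q ^ j" for j
    unfolding prob_Z thin_mass_1_Suc[OF param] b_def q_def by simp
  have "(\<lambda>j. real (Suc j) * prob {\<omega> \<in> space M. Z i \<omega> = Suc j}) sums (b * (r + 1)\<^sup>2)"
    using sums_mult[OF first, of b] by (simp only: mass mult_ac)
  moreover have "b * (r + 1)\<^sup>2 = m" using r1 by (simp add: b_def)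
  ultimately have mean: "(\<lambda>k. real k * prob {\<omega> \<in> space M. Z i \<omega> = k}) sums m"
    using sums_Suc_iff[of "\<lambda>k. real k * prob {\<omega> \<in> space M. Z i \<omega> = k}" m] by simp
  show "integrable M (\<lambda>\<omega>. real (Z i \<omega>))" "expectation (\<lambda>\<omega>. real (Z i \<omega>)) = m"
    using integral_nat_valued[OF measurable_Z _ mean] by auto
  have square: "(real (Suc j))\<^sup>2 = 2 * real (Suc (Suc j) choose 2) - real (Suc j)" for j
  proof -
    have "even (Suc (Suc j) * Suc j)" by simp
    then have "2 * (Suc (Suc j) choose 2) = Suc (Suc j) * Suc j"
      by (simp add: choose_two)
    then have "2 * real (Suc (Suc j) choose 2) = real (Suc (Suc j)) * real (Suc j)"
      by (metis of_nat_mult of_nat_numeral)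
    then show ?thesis by (simp add: power2_eq_square algebra_simps)
  qed
  have "(\<lambda>j. b * (2 * (real (Suc (Suc j) choose 2) * q ^ j) - real (Suc j) * q ^ j))
      sums (b * (2 * (r + 1) ^ 3 - (r + 1)\<^sup>2))"
    by (intro sums_mult sums_diff first second)
  moreover have "b * (2 * (real (Suc (Suc j) choose 2) * q ^ j) - real (Suc j) * q ^ j)
      = (real (Suc j))\<^sup>2 * prob {\<omega> \<in> space M. Z i \<omega> = Suc j}" for j
    unfolding square mass by (simp only: algebra_simps)
  moreover have "b * (2 * (r + 1) ^ 3 - (r + 1)\<^sup>2) = (2 * r + 1) * m"
  proof -
    have "b * (2 * (r + 1) ^ 3 - (r + 1)\<^sup>2) = b * (r + 1)\<^sup>2 * (2 * r + 1)"
      by (simp add: power2_eq_square power3_eq_cube algebra_simps)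
    then show ?thesis using \<open>b * (r + 1)\<^sup>2 = m\<close> by simp
  qed
  ultimately have "(\<lambda>j. (real (Suc j))\<^sup>2 * prob {\<omega> \<in> space M. Z i \<omega> = Suc j}) sums ((2 * r + 1) * m)"
    by (simp only:)
  then have sq: "(\<lambda>k. (real k)\<^sup>2 * prob {\<omega> \<in> space M. Z i \<omega> = k}) sums ((2 * r + 1) * m)"
    using sums_Suc_iff[of "\<lambda>k. (real k)\<^sup>2 * prob {\<omega> \<in> space M. Z i \<omega> = k}" "(2 * r + 1) * m"]
    by simp
  show "integrable M (\<lambda>\<omega>. (real (Z i \<omega>))\<^sup>2)" "expectation (\<lambda>\<omega>. (real (Z i \<omega>))\<^sup>2) = (2 * r + 1) * m"
    using integral_nat_valued[OF measurable_Z _ sq] by auto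
qed

lemma expectation_partial_sum:
  "integrable M (\<lambda>\<omega>. real (\<Sum>i<n. Z i \<omega>))"
  "expectation (\<lambda>\<omega>. real (\<Sum>i<n. Z i \<omega>)) = m * real n"
  by (simp_all add: expectation_Z)

text \<open>Expanding the square of \<open>S + Z n\<close>, where \<open>S\<close> is the sum of the first \<open>n\<close> terms, leaves a mixed term
whose expectation factors because \<open>Z n\<close> is independent of \<open>S\<close>.\<close>

lemma expectation_partial_sum_square:
  "integrable M (\<lambda>\<omega>. (real (\<Sum>i<n. Z i \<omega>))\<^sup>2) \<and>
   expectation (\<lambda>\<omega>. (real (\<Sum>i<n. Z i \<omega>))\<^sup>2)
     = (2 * r + 1) * m * real n + m\<^sup>2 * real n * (real n - 1)"
proof (induction n)
  case 0
  then show ?case by simp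
next
  case (Suc n)
  let ?S = "\<lambda>\<omega>. real (\<Sum>i<n. Z i \<omega>)" and ?Z = "\<lambda>\<omega>. real (Z n \<omega>)"
  have "indep_vars (\<lambda>_. borel) (\<lambda>i \<omega>. real (Z i \<omega>)) (insert n {..<n})"
    by (rule indep_vars_compose2[OF indep_vars_subset[OF indep_Z]]) auto
  then have ind: "indep_var borel ?Z borel ?S"
    using indep_vars_sum[of "{..<n}" n "\<lambda>i \<omega>. real (Z i \<omega>)"] by simp
  note int = indep_var_integrable[OF ind expectation_Z(1) expectation_partial_sum(1)]
    and prod = indep_var_lebesgue_integral[OF ind expectation_Z(1) expectation_partial_sum(1)]
  have expand: "(\<lambda>\<omega>. (real (\<Sum>i<Suc n. Z i \<omega>))\<^sup>2) = (\<lambda>\<omega>. (?S \<omega>)\<^sup>2 + 2 * (?Z \<omega> * ?S \<omega>) + (?Z \<omega>)\<^sup>2)"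
    by (simp only: sum.lessThan_Suc of_nat_add power2_sum mult_ac add_ac)
  have S: "integrable M (\<lambda>\<omega>. (?S \<omega>)\<^sup>2)" "expectation (\<lambda>\<omega>. (?S \<omega>)\<^sup>2)
     = (2 * r + 1) * m * real n + m\<^sup>2 * real n * (real n - 1)"
    using Suc.IH by auto
  note ints = S(1) integrable_mult_right[OF int, of 2] expectation_Z_square(1)[of n]
  have "expectation (\<lambda>\<omega>. (?S \<omega>)\<^sup>2 + 2 * (?Z \<omega> * ?S \<omega>) + (?Z \<omega>)\<^sup>2)
      = expectation (\<lambda>\<omega>. (?S \<omega>)\<^sup>2) + 2 * (m * (m * real n)) + (2 * r + 1) * m"
    by (simp only: Bochner_Integration.integral_add[OF Bochner_Integration.integrable_add[OF ints(1,2)] ints(3)]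
       Bochner_Integration.integral_add[OF ints(1,2)] integral_mult_right_zero prod
       expectation_Z expectation_Z_square expectation_partial_sum)
  also have "\<dots> = (2 * r + 1) * m * real (Suc n) + m\<^sup>2 * real (Suc n) * (real (Suc n) - 1)"
    unfolding S(2) by (simp add: power2_eq_square algebra_simps)
  finally show ?case
    unfolding expand using Bochner_Integration.integrable_add[OF Bochner_Integration.integrable_add[OF ints(1,2)] ints(3)]
    by (intro conjI)
qed

lemma nn_integral_partial_sum:
  "(\<integral>\<^sup>+\<omega>. ennreal (real (\<Sum>i<n. Z i \<omega>)) \<partial>M) = ennreal (m * real n)"
  using nn_integral_eq_integral[OF expectation_partial_sum(1)[of n]] expectation_partial_sum(2)[of n]
  by (simp add: sum_nonneg)

lemma nn_integral_partial_sum_square: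
  "(\<integral>\<^sup>+\<omega>. ennreal ((real (\<Sum>i<n. Z i \<omega>))\<^sup>2) \<partial>M)
    = ennreal ((2 * r + 1) * m * real n + m\<^sup>2 * real n * (real n - 1))"
  using nn_integral_eq_integral[of M "\<lambda>\<omega>. (real (\<Sum>i<n. Z i \<omega>))\<^sup>2"]
    expectation_partial_sum_square[of n] by simp

text \<open>The centre is left arbitrary: \<open>c = m * n\<close> gives the conditional variance, and \<open>m\<close> times the mean of
\<open>X\<close> gives the total variance.\<close>

lemma nn_integral_partial_sum_centred_square:
  "(\<integral>\<^sup>+\<omega>. ennreal ((real (\<Sum>i<n. Z i \<omega>) - c)\<^sup>2) \<partial>M)
    = ennreal (m * (2 * r + 1 - m) * real n + (m * real n - c)\<^sup>2)"
proof -
  let ?S = "\<lambda>\<omega>. real (\<Sum>i<n. Z i \<omega>)"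
  have sq: "integrable M (\<lambda>\<omega>. (?S \<omega>)\<^sup>2)" "expectation (\<lambda>\<omega>. (?S \<omega>)\<^sup>2)
     = (2 * r + 1) * m * real n + m\<^sup>2 * real n * (real n - 1)"
    using expectation_partial_sum_square by auto
  have expand: "(\<lambda>\<omega>. (?S \<omega> - c)\<^sup>2) = (\<lambda>\<omega>. (?S \<omega>)\<^sup>2 + ((- 2 * c) * ?S \<omega> + c\<^sup>2))"
    by (simp add: power2_eq_square algebra_simps fun_eq_iff del: of_nat_sum)
  have int: "integrable M (\<lambda>\<omega>. (- 2 * c) * ?S \<omega>)"
    by (intro integrable_mult_right expectation_partial_sum)
  have int2: "integrable M (\<lambda>\<omega>. (- 2 * c) * ?S \<omega> + c\<^sup>2)"
    by (intro Bochner_Integration.integrable_add int) simp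
  have "expectation (\<lambda>\<omega>. (?S \<omega> - c)\<^sup>2)
      = expectation (\<lambda>\<omega>. (?S \<omega>)\<^sup>2) + ((- 2 * c) * (m * real n) + c\<^sup>2)"
    unfolding expand Bochner_Integration.integral_add[OF sq(1) int2]
      Bochner_Integration.integral_add[OF int integrable_const]
      integral_mult_right_zero expectation_partial_sum(2) by (simp add: prob_space)
  also have "\<dots> = m * (2 * r + 1 - m) * real n + (m * real n - c)\<^sup>2"
    unfolding sq(2) by (simp add: power2_eq_square algebra_simps)
  finally show ?thesis
    using nn_integral_eq_integral[of M "\<lambda>\<omega>. (?S \<omega> - c)\<^sup>2"]
      Bochner_Integration.integrable_add[OF sq(1) int2] unfolding expand by simp
qed

end

section \<open>Sums of a random number of terms\<close>

locale thinning = iid_psi_sequence +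
  fixes X :: "'a \<Rightarrow> nat"
  assumes indep_X_Z: "indep_rv M nat_space X seq_space (seq_rv Z)"
begin

lemma measurable_X [measurable]: "random_variable nat_space X"
  using indep_X_Z by (simp add: indep_rv_def)

lemma measurable_thin [measurable]: "random_variable nat_space (thin Z X)"
  unfolding thin_def
  by (rule measurable_compose_countable[where f = "\<lambda>n \<omega>. \<Sum>i<n. Z i \<omega>"]) measurable

lemma indep_X_partial_sum: "indep_var nat_space X nat_space (\<lambda>\<omega>. \<Sum>i<n. Z i \<omega>)"
  using indep_rv_compose_indep_var[OF indep_X_Z, where g = "\<lambda>z. \<Sum>i<n. z i" and S' = nat_space]
  by (simp add: seq_rv_def)

sublocale sigma_finite_subalgebra M "sigma_gen M X"
  by (rule sigma_finite_subalgebra_sigma_gen[OF measurable_X])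

lemma nn_integral_thin:
  "(\<integral>\<^sup>+\<omega>. g (X \<omega>) (thin Z X \<omega>) \<partial>M) = (\<integral>\<^sup>+\<omega>. (\<integral>\<^sup>+\<eta>. g (X \<omega>) (\<Sum>i<X \<omega>. Z i \<eta>) \<partial>M) \<partial>M)"
  unfolding thin_def by (rule nn_integral_freeze[OF indep_X_partial_sum])

lemma nn_cond_exp_thin:
  "AE \<omega> in M. nn_cond_exp M (sigma_gen M X) (\<lambda>\<eta>. g (X \<eta>) (thin Z X \<eta>)) \<omega>
    = (\<integral>\<^sup>+\<eta>. g (X \<omega>) (\<Sum>i<X \<omega>. Z i \<eta>) \<partial>M)"
  unfolding thin_def by (rule nn_cond_exp_freeze[OF indep_X_partial_sum])

lemma nn_cond_exp_thin_mean:
  "AE \<omega> in M. nn_cond_exp M (sigma_gen M X) (\<lambda>\<eta>. ennreal (real (thin Z X \<eta>))) \<omega>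
    = ennreal (m * real (X \<omega>))"
  using nn_cond_exp_thin[of "\<lambda>_ t. ennreal (real t)"] unfolding nn_integral_partial_sum .

lemma nn_cond_exp_thin_square:
  "AE \<omega> in M. nn_cond_exp M (sigma_gen M X) (\<lambda>\<eta>. ennreal ((real (thin Z X \<eta>))\<^sup>2)) \<omega>
    = ennreal ((2 * r + 1) * m * real (X \<omega>) + m\<^sup>2 * real (X \<omega>) * (real (X \<omega>) - 1))"
  using nn_cond_exp_thin[of "\<lambda>_ t. ennreal ((real t)\<^sup>2)"] unfolding nn_integral_partial_sum_square .

text \<open>The conditional mean can be replaced by \<open>m * X\<close>, which is a function of \<open>X\<close> and therefore frozen
along with it; this leaves the variance of a sum with a fixed number of terms.\<close>

lemma cond_variance_thin:
  "AE \<omega> in M. cond_variance M (sigma_gen M X) (\<lambda>\<eta>. real (thin Z X \<eta>)) \<omega>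
    = ennreal (m * (2 * r + 1 - m) * real (X \<omega>))"
proof -
  have "AE \<omega> in M. real_cond_exp M (sigma_gen M X) (\<lambda>\<eta>. real (thin Z X \<eta>)) \<omega> = m * real (X \<omega>)"
    using real_cond_exp_nonneg[of "\<lambda>\<eta>. real (thin Z X \<eta>)"] nn_cond_exp_thin_mean m_pos by auto
  then have "AE \<omega> in M. nn_cond_exp M (sigma_gen M X)
      (\<lambda>\<eta>. ennreal ((real (thin Z X \<eta>)
        - real_cond_exp M (sigma_gen M X) (\<lambda>\<eta>. real (thin Z X \<eta>)) \<eta>)\<^sup>2)) \<omega>
      = nn_cond_exp M (sigma_gen M X)
      (\<lambda>\<eta>. ennreal ((real (thin Z X \<eta>) - m * real (X \<eta>))\<^sup>2)) \<omega>"
    by (intro nn_cond_exp_cong) auto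
  moreover have "AE \<omega> in M. nn_cond_exp M (sigma_gen M X)
      (\<lambda>\<eta>. ennreal ((real (thin Z X \<eta>) - m * real (X \<eta>))\<^sup>2)) \<omega>
      = ennreal (m * (2 * r + 1 - m) * real (X \<omega>))"
    using nn_cond_exp_thin[of "\<lambda>n t. ennreal ((real t - m * real n)\<^sup>2)"]
    unfolding nn_integral_partial_sum_centred_square by simp
  ultimately show ?thesis unfolding cond_variance_def by auto
qed

lemma nn_integral_thin_mean:
  "(\<integral>\<^sup>+\<omega>. ennreal (real (thin Z X \<omega>)) \<partial>M) = ennreal m * (\<integral>\<^sup>+\<omega>. ennreal (real (X \<omega>)) \<partial>M)"
proof -
  have "(\<integral>\<^sup>+\<omega>. ennreal (real (thin Z X \<omega>)) \<partial>M) = (\<integral>\<^sup>+\<omega>. ennreal m * ennreal (real (X \<omega>)) \<partial>M)"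
    using nn_integral_thin[of "\<lambda>_ t. ennreal (real t)"] m_pos
    unfolding nn_integral_partial_sum by (simp add: ennreal_mult)
  then show ?thesis by (simp add: nn_integral_cmult)
qed

text \<open>One computation treats finite and infinite moments alike. The Bochner mean \<open>\<mu>\<close> of \<open>X\<close> is the real
part of its mean in \<open>[0,\<infinity>]\<close>, so the Bochner mean of the thinned variable is \<open>m * \<mu>\<close> also when both
are \<open>0\<close> for lack of integrability. Centring at \<open>m * \<mu>\<close> and conditioning on \<open>X\<close> then splits the
square, inside one integral with values in \<open>[0,\<infinity>]\<close>.\<close>

lemma ext_variance_thin:
  "ext_variance M (\<lambda>\<omega>. real (thin Z X \<omega>))
    = ennreal (m\<^sup>2) * ext_variance M (\<lambda>\<omega>. real (X \<omega>))
      + ennreal (m * (2 * r + 1 - m)) * (\<integral>\<^sup>+\<omega>. ennreal (real (X \<omega>)) \<partial>M)"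
proof -
  define \<mu> where "\<mu> = expectation (\<lambda>\<omega>. real (X \<omega>))"
  have mean: "expectation (\<lambda>\<omega>. real (thin Z X \<omega>)) = m * \<mu>"
    using m_pos by (simp add: \<mu>_def integral_eq_nn_integral nn_integral_thin_mean enn2real_mult)
  have "ext_variance M (\<lambda>\<omega>. real (thin Z X \<omega>))
      = (\<integral>\<^sup>+\<omega>. ennreal (m * (2 * r + 1 - m) * real (X \<omega>) + (m * real (X \<omega>) - m * \<mu>)\<^sup>2) \<partial>M)"
    unfolding ext_variance_def mean
    using nn_integral_thin[of "\<lambda>_ t. ennreal ((real t - m * \<mu>)\<^sup>2)"]
    unfolding nn_integral_partial_sum_centred_square .
  also have "\<dots> = (\<integral>\<^sup>+\<omega>. ennreal (m\<^sup>2) * ennreal ((real (X \<omega>) - \<mu>)\<^sup>2)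
      + ennreal (m * (2 * r + 1 - m)) * ennreal (real (X \<omega>)) \<partial>M)"
  proof (intro nn_integral_cong)
    fix \<omega>
    have "(m * real (X \<omega>) - m * \<mu>)\<^sup>2 = m\<^sup>2 * (real (X \<omega>) - \<mu>)\<^sup>2"
      by (simp add: power_mult_distrib flip: right_diff_distrib)
    then show "ennreal (m * (2 * r + 1 - m) * real (X \<omega>) + (m * real (X \<omega>) - m * \<mu>)\<^sup>2)
        = ennreal (m\<^sup>2) * ennreal ((real (X \<omega>) - \<mu>)\<^sup>2)
          + ennreal (m * (2 * r + 1 - m)) * ennreal (real (X \<omega>))"
      using variance_factor_nonneg
      by (simp only: ennreal_mult[symmetric] ennreal_plus[symmetric] zero_le_power2
          of_nat_0_le_iff mult_nonneg_nonneg add.commute)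
  qed
  also have "\<dots> = ennreal (m\<^sup>2) * ext_variance M (\<lambda>\<omega>. real (X \<omega>))
      + ennreal (m * (2 * r + 1 - m)) * (\<integral>\<^sup>+\<omega>. ennreal (real (X \<omega>)) \<partial>M)"
    by (simp add: nn_integral_add nn_integral_cmult ext_variance_def \<mu>_def)
  finally show ?thesis .
qed

lemma cond_probability_thin:
  "AE \<omega> in M. cond_probability M (sigma_gen M X) {\<eta> \<in> space M. thin Z X \<eta> = k} \<omega>
    = thin_mass m r (X \<omega>) k"
proof -
  let ?A = "{\<eta> \<in> space M. thin Z X \<eta> = k}"
  have cond: "(\<integral>\<^sup>+\<eta>. indicator {k} (\<Sum>i<n. Z i \<eta>) \<partial>M) = ennreal (thin_mass m r n k)" for n
  proof -
    have "(\<integral>\<^sup>+\<eta>. indicator {k} (\<Sum>i<n. Z i \<eta>) \<partial>M)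
        = (\<integral>\<^sup>+\<eta>. indicator {\<eta> \<in> space M. (\<Sum>i<n. Z i \<eta>) = k} \<eta> \<partial>M)"
      by (intro nn_integral_cong) (simp add: indicator_def)
    also have "\<dots> = ennreal (prob {\<eta> \<in> space M. (\<Sum>i<n. Z i \<eta>) = k})"
      by (subst nn_integral_indicator) (simp_all add: emeasure_eq_measure)
    finally show ?thesis unfolding prob_partial_sum .
  qed
  have "AE \<omega> in M. nn_cond_exp M (sigma_gen M X) (\<lambda>\<eta>. ennreal (indicator ?A \<eta>)) \<omega>
      = nn_cond_exp M (sigma_gen M X) (\<lambda>\<eta>. indicator {k} (thin Z X \<eta>)) \<omega>"
    by (intro nn_cond_exp_cong AE_I2 measurable_compose[OF measurable_thin])
      (auto simp: indicator_def)
  moreover have "AE \<omega> in M. nn_cond_exp M (sigma_gen M X) (\<lambda>\<eta>. indicator {k} (thin Z X \<eta>)) \<omega>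
      = ennreal (thin_mass m r (X \<omega>) k)"
    using nn_cond_exp_thin[of "\<lambda>_. indicator {k}"] unfolding cond .
  moreover have "thin_mass m r n k \<ge> 0" for n
    unfolding prob_partial_sum[symmetric] by simp
  ultimately show ?thesis
    using real_cond_exp_nonneg[of "indicator ?A"] unfolding cond_probability_def by auto
qed

text \<open>Thinning acts on generating functions by composition with \<open>psi m r\<close>.\<close>

lemma expectation_power_thin:
  assumes s: "0 \<le> s" "s \<le> 1"
  shows "expectation (\<lambda>\<omega>. s ^ thin Z X \<omega>) = expectation (\<lambda>\<omega>. psi m r s ^ X \<omega>)"
proof -
  have "(\<integral>\<^sup>+\<omega>. ennreal (s ^ (\<Sum>i<n. Z i \<omega>)) \<partial>M) = ennreal (psi m r s ^ n)" for n
    using s nn_integral_eq_integral[OF integrable_power_bounded_base, of "\<lambda>\<omega>. \<Sum>i<n. Z i \<omega>" s]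
    by (simp add: expectation_power_partial_sum)
  then have "(\<integral>\<^sup>+\<omega>. ennreal (s ^ thin Z X \<omega>) \<partial>M) = (\<integral>\<^sup>+\<omega>. ennreal (psi m r s ^ X \<omega>) \<partial>M)"
    using nn_integral_thin[of "\<lambda>_ t. ennreal (s ^ t)"] by simp
  then show ?thesis
    using s psi_nonneg[of s] by (simp add: integral_eq_nn_integral)
qed

end

lemma thinning_if_thinning_seq:
  assumes "(m, r) \<in> param_region" "prob_space M" "thinning_seq M m r X Z"
  shows "thinning M m r Z X"
proof -
  interpret prob_space M by fact
  show ?thesis
    using assms(1,3) unfolding thinning_seq_def by unfold_locales auto
qed

text \<open>Both sides have the generating function \<open>E (psi m r s ^ X) * E (psi m r s ^ Y)\<close>: on the left,
because \<open>X\<close> and \<open>Y\<close> are independent; on the right, because the two thinned variables are functions of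
the independent pairs \<open>(X, Z\<^sub>X)\<close> and \<open>(Y, Z\<^sub>Y)\<close>.\<close>

lemma thin_add_distr:
  assumes "thinning M m r Z\<^sub>S (\<lambda>\<omega>. X \<omega> + Y \<omega>)" "thinning M m r Z\<^sub>X X" "thinning M m r Z\<^sub>Y Y"
    and indep_XY: "prob_space.indep_var M nat_space X nat_space Y"
    and indep: "prob_space.indep_var M
      (nat_space \<Otimes>\<^sub>M seq_space) (\<lambda>\<omega>. (X \<omega>, seq_rv Z\<^sub>X \<omega>))
      (nat_space \<Otimes>\<^sub>M seq_space) (\<lambda>\<omega>. (Y \<omega>, seq_rv Z\<^sub>Y \<omega>))"
  shows "distr M nat_space (thin Z\<^sub>S (\<lambda>\<omega>. X \<omega> + Y \<omega>))
    = distr M nat_space (\<lambda>\<omega>. thin Z\<^sub>X X \<omega> + thin Z\<^sub>Y Y \<omega>)"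
proof -
  interpret S: thinning M m r Z\<^sub>S "\<lambda>\<omega>. X \<omega> + Y \<omega>" by fact
  interpret X: thinning M m r Z\<^sub>X X by fact
  interpret Y: thinning M m r Z\<^sub>Y Y by fact
  let ?T = "\<lambda>(n, z). \<Sum>i<n. z i :: nat"
  have T: "?T \<in> measurable (nat_space \<Otimes>\<^sub>M seq_space) nat_space"
    unfolding split_beta
    by (rule measurable_compose_countable[where f = "\<lambda>n p. \<Sum>i<n. snd p i" and g = fst]) measurable
  have "S.indep_var nat_space (?T \<circ> (\<lambda>\<omega>. (X \<omega>, seq_rv Z\<^sub>X \<omega>))) nat_space (?T \<circ> (\<lambda>\<omega>. (Y \<omega>, seq_rv Z\<^sub>Y \<omega>)))"
    by (rule S.indep_var_compose[OF indep T T])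
  also have "?T \<circ> (\<lambda>\<omega>. (X \<omega>, seq_rv Z\<^sub>X \<omega>)) = thin Z\<^sub>X X"
    by (simp add: fun_eq_iff thin_def seq_rv_def)
  also have "?T \<circ> (\<lambda>\<omega>. (Y \<omega>, seq_rv Z\<^sub>Y \<omega>)) = thin Z\<^sub>Y Y"
    by (simp add: fun_eq_iff thin_def seq_rv_def)
  finally have indep_T: "S.indep_var nat_space (thin Z\<^sub>X X) nat_space (thin Z\<^sub>Y Y)" .
  have factor: "S.expectation (\<lambda>\<omega>. s ^ (U \<omega> + V \<omega>))
      = S.expectation (\<lambda>\<omega>. s ^ U \<omega>) * S.expectation (\<lambda>\<omega>. s ^ V \<omega>)"
    if ind: "S.indep_var nat_space U nat_space V" and s: "0 \<le> s" "s \<le> 1"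
    for U V :: "'a \<Rightarrow> nat" and s :: real
  proof -
    have "S.indep_var borel ((\<lambda>k. s ^ k) \<circ> U) borel ((\<lambda>k. s ^ k) \<circ> V)"
      by (rule S.indep_var_compose[OF ind]) auto
    then have "S.indep_var borel (\<lambda>\<omega>. s ^ U \<omega>) borel (\<lambda>\<omega>. s ^ V \<omega>)"
      by (simp add: comp_def)
    from S.indep_var_lebesgue_integral[OF this] show ?thesis
      using S.indep_var_rv1[OF ind] S.indep_var_rv2[OF ind] s
      by (simp add: power_add S.integrable_power_bounded_base)
  qed
  have pgf: "S.expectation (\<lambda>\<omega>. s ^ thin Z\<^sub>S (\<lambda>\<omega>. X \<omega> + Y \<omega>) \<omega>)
      = S.expectation (\<lambda>\<omega>. s ^ (thin Z\<^sub>X X \<omega> + thin Z\<^sub>Y Y \<omega>))"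
    if s: "0 \<le> s" "s \<le> 1" for s :: real
  proof -
    have "S.expectation (\<lambda>\<omega>. s ^ thin Z\<^sub>S (\<lambda>\<omega>. X \<omega> + Y \<omega>) \<omega>)
        = S.expectation (\<lambda>\<omega>. psi m r s ^ (X \<omega> + Y \<omega>))"
      by (rule S.expectation_power_thin[OF s])
    also have "\<dots> = S.expectation (\<lambda>\<omega>. psi m r s ^ X \<omega>) * S.expectation (\<lambda>\<omega>. psi m r s ^ Y \<omega>)"
      by (intro factor indep_XY S.psi_nonneg S.psi_le_1 s)
    also have "\<dots> = S.expectation (\<lambda>\<omega>. s ^ thin Z\<^sub>X X \<omega>) * S.expectation (\<lambda>\<omega>. s ^ thin Z\<^sub>Y Y \<omega>)"
      by (simp only: X.expectation_power_thin[OF s] Y.expectation_power_thin[OF s])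
    also have "\<dots> = S.expectation (\<lambda>\<omega>. s ^ (thin Z\<^sub>X X \<omega> + thin Z\<^sub>Y Y \<omega>))"
      by (rule factor[OF indep_T s, symmetric])
    finally show ?thesis .
  qed
  show ?thesis
  proof (rule distr_nat_eqI)
    fix k
    have "S.prob {\<omega> \<in> space M. thin Z\<^sub>S (\<lambda>\<omega>. X \<omega> + Y \<omega>) \<omega> = k}
        = S.prob {\<omega> \<in> space M. thin Z\<^sub>X X \<omega> + thin Z\<^sub>Y Y \<omega> = k}"
      by (rule S.prob_eq_of_pgf_sums) (simp_all add: pgf S.pgf_sums)
    then show "emeasure M {\<omega> \<in> space M. thin Z\<^sub>S (\<lambda>\<omega>. X \<omega> + Y \<omega>) \<omega> = k}
        = emeasure M {\<omega> \<in> space M. thin Z\<^sub>X X \<omega> + thin Z\<^sub>Y Y \<omega> = k}"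
      by (simp add: S.emeasure_eq_measure)
  qed measurable
qed

theorem proposition2p7:
  fixes m r :: real
    and M :: "'a measure"
    and X :: "'a \<Rightarrow> nat"
    and Z :: "nat \<Rightarrow> 'a \<Rightarrow> nat"
  assumes "(m, r) \<in> param_region"
    and "prob_space M"
    and "X \<in> measurable M nat_space"
    and "thinning_seq M m r X Z"
  shows
    "(AE \<omega> in M. nn_cond_exp M (sigma_gen M X) (\<lambda>\<eta>. ennreal (real (thin Z X \<eta>))) \<omega>
        = ennreal (m * real (X \<omega>)))
   \<and> (AE \<omega> in M. nn_cond_exp M (sigma_gen M X) (\<lambda>\<eta>. ennreal ((real (thin Z X \<eta>))\<^sup>2)) \<omega>
        = ennreal ((2 * r + 1) * m * real (X \<omega>) + m\<^sup>2 * real (X \<omega>) * (real (X \<omega>) - 1)))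
   \<and> (AE \<omega> in M. cond_variance M (sigma_gen M X) (\<lambda>\<eta>. real (thin Z X \<eta>)) \<omega>
        = ennreal (m * (2 * r + 1 - m) * real (X \<omega>)))
   \<and> ((\<integral>\<^sup>+\<omega>. ennreal (real (thin Z X \<omega>)) \<partial>M)
        = ennreal m * (\<integral>\<^sup>+\<omega>. ennreal (real (X \<omega>)) \<partial>M)
      \<and> ext_variance M (\<lambda>\<omega>. real (thin Z X \<omega>))
        = ennreal (m\<^sup>2) * ext_variance M (\<lambda>\<omega>. real (X \<omega>))
          + ennreal (m * (2 * r + 1 - m)) * (\<integral>\<^sup>+\<omega>. ennreal (real (X \<omega>)) \<partial>M))
   \<and> (\<forall>k. AE \<omega> in M.
        cond_probability M (sigma_gen M X) {\<eta> \<in> space M. thin Z X \<eta> = k} \<omega>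
          = thin_mass m r (X \<omega>) k)
   \<and> (\<forall>Y Z\<^sub>S Z\<^sub>X Z\<^sub>Y.
        prob_space.indep_var M nat_space X nat_space Y \<longrightarrow>
        thinning_seq M m r (\<lambda>\<omega>. X \<omega> + Y \<omega>) Z\<^sub>S \<longrightarrow>
        thinning_seq M m r X Z\<^sub>X \<longrightarrow>
        thinning_seq M m r Y Z\<^sub>Y \<longrightarrow>
        prob_space.indep_var M
          (nat_space \<Otimes>\<^sub>M seq_space) (\<lambda>\<omega>. (X \<omega>, seq_rv Z\<^sub>X \<omega>))
          (nat_space \<Otimes>\<^sub>M seq_space) (\<lambda>\<omega>. (Y \<omega>, seq_rv Z\<^sub>Y \<omega>)) \<longrightarrow>
        distr M nat_space (thin Z\<^sub>S (\<lambda>\<omega>. X \<omega> + Y \<omega>))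
          = distr M nat_space (\<lambda>\<omega>. thin Z\<^sub>X X \<omega> + thin Z\<^sub>Y Y \<omega>))"
proof -
  interpret thinning M m r Z X
    by (rule thinning_if_thinning_seq[OF assms(1,2,4)])
  note thinning = thinning_if_thinning_seq[OF assms(1,2)]
  show ?thesis
    by (intro conjI allI impI nn_cond_exp_thin_mean nn_cond_exp_thin_square cond_variance_thin
        nn_integral_thin_mean ext_variance_thin cond_probability_thin)
      (rule thin_add_distr[OF thinning thinning thinning])
qed

end
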